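(* For each integer $d\ge1$, let $C_d\subset\mathbb{R}^d$ be the convex hull of \[\{\pm \mathbf{e}_i : 1\le i\le d\}\cup\{\pm(\mathbf{e}_i+\cdots+\mathbf{e}_j): 1\le i<j\le d-1\}\cup\{\pm(2\mathbf{e}_i+\cdots+2\mathbf{e}_{d-1}+\mathbf{e}_d): 1\le i\le d-1\},\] where $\mathbf{e}_1,\dots,\mathbf{e}_d$ are the standard unit vectors, let $C_d^*=\{u\in\mathbb{R}^d:\langle u,v\rangle\le1\ \forall v\in C_d\}$ be its dual polytope, and let $E_{C_d^*}(k)$ be the Ehrhart polynomial of $C_d^*$. Then every complex root of $E_{C_d^*}$ has real part equal to $-1/2$ (i.e. $C_d^*$ is a CL-polytope). Moreover, the sequence $\{E_{C_d^*}\}_{d\ge1}$ has the interlacing property with respect to the line $L=\{-\tfrac12+ti : t\in\mathbb{R}\}$: for every $d\ge1$, writing the roots of $E_{C_{d+1}^*}$ as $-\tfrac12+t_1 i,\dots,-\tfrac12+t_{d+1}i$ and those of $E_{C_d^*}$ as $-\tfrac12+s_1i,\dots,-\tfrac12+s_di$ (each list sorted increasingly, with multiplicity), one has \[t_1\le s_1\le t_2\le s_2\le\cdots\le t_d\le s_d\le t_{d+1}.\]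
   Context: For a $d$-dimensional lattice polytope $P\subset\mathbb{R}^d$ (all vertices in $\mathbb{Z}^d$), its Ehrhart polynomial $E_P$ is the unique polynomial of degree $d$ with $E_P(k)=|kP\cap\mathbb{Z}^d|$ for all positive integers $k$, where $kP=\{k\alpha:\alpha\in P\}$. A reflexive polytope all of whose Ehrhart polynomial roots lie on the line $\mathrm{Re}(z)=-1/2$ is called a CL-polytope. $\langle\cdot,\cdot\rangle$ is the standard inner product. *)

theory Defs
  imports
    "HOL-Analysis.Analysis"
    "HOL-Analysis.Finite_Function_Topology"
    "HOL-Computational_Algebra.Computational_Algebra"
begin

text \<open>
  The dimension varies inside the statement, so all spaces \<open>\<real>\<^sup>d\<close> live in the
  single real vector space of finitely supported functions on the naturals: \<open>\<real>\<^sup>d\<close> is the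
  subspace supported on the coordinates \<open>1, \<dots>, d\<close>.  The library norm on this type is the
  \<open>\<ell>\<^sub>1\<close> norm, so it induces the Euclidean topology on every \<open>\<real>\<^sup>d\<close>.
\<close>

type_synonym rvec = "nat \<Rightarrow>\<^sub>0 real"

definition Rd :: "nat \<Rightarrow> rvec set" where
  "Rd d = {x. Poly_Mapping.keys x \<subseteq> {1..d}}"

definition Zd :: "nat \<Rightarrow> rvec set" where
  "Zd d = {x \<in> Rd d. \<forall>i. Poly_Mapping.lookup x i \<in> \<int>}"

definition unit_vec :: "nat \<Rightarrow> rvec" where
  "unit_vec i = Poly_Mapping.single i 1"

definition dot :: "nat \<Rightarrow> rvec \<Rightarrow> rvec \<Rightarrow> real" where
  "dot d u v = (\<Sum>i=1..d. Poly_Mapping.lookup u i * Poly_Mapping.lookup v i)"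

definition dual_polytope :: "nat \<Rightarrow> rvec set \<Rightarrow> rvec set" where
  "dual_polytope d P = {u \<in> Rd d. \<forall>v\<in>P. dot d u v \<le> 1}"

text \<open>The condition on the affine hull says that the polytope has full dimension \<open>d\<close>
  (the library's \<open>aff_dim\<close> is restricted to Euclidean types).\<close>

definition lattice_polytope :: "nat \<Rightarrow> rvec set \<Rightarrow> bool" where
  "lattice_polytope d P \<longleftrightarrow>
     polytope P \<and> affine hull P = Rd d \<and> (\<forall>v. v extreme_point_of P \<longrightarrow> v \<in> Zd d)"

definition reflexive_polytope :: "nat \<Rightarrow> rvec set \<Rightarrow> bool" where
  "reflexive_polytope d P \<longleftrightarrow>
     lattice_polytope d P \<and> 0 \<in> top_of_set (Rd d) interior_of P \<and>
     lattice_polytope d (dual_polytope d P)"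

definition is_ehrhart_poly :: "nat \<Rightarrow> rvec set \<Rightarrow> complex poly \<Rightarrow> bool" where
  "is_ehrhart_poly d P p \<longleftrightarrow>
     degree p = d \<and>
     (\<forall>k::nat. k > 0 \<longrightarrow>
        poly p (of_nat k) = of_nat (card ((\<lambda>\<alpha>. real k *\<^sub>R \<alpha>) ` P \<inter> Zd d)))"

definition ehrhart_poly :: "nat \<Rightarrow> rvec set \<Rightarrow> complex poly" where
  "ehrhart_poly d P = (THE p. is_ehrhart_poly d P p)"

lemma is_ehrhart_poly_unique:
  assumes "is_ehrhart_poly d P p" "is_ehrhart_poly d P q"
  shows "p = q"
proof (rule ccontr)
  assume "p \<noteq> q"
  then have "finite {x. poly (p - q) x = 0}"
    by (intro poly_roots_finite) simp
  moreover have "of_nat ` {0<..} \<subseteq> {x. poly (p - q) x = 0}"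
    using assms by (auto simp: is_ehrhart_poly_def)
  ultimately have "finite ((of_nat :: nat \<Rightarrow> complex) ` {0<..})"
    by (rule rev_finite_subset)
  then have "finite {0::nat<..}"
    by (rule finite_imageD) (simp add: inj_on_def)
  then show False
    by (simp add: infinite_Ioi)
qed

definition CL_polytope :: "nat \<Rightarrow> rvec set \<Rightarrow> bool" where
  "CL_polytope d P \<longleftrightarrow>
     reflexive_polytope d P \<and> (\<forall>z. poly (ehrhart_poly d P) z = 0 \<longrightarrow> Re z = - 1 / 2)"

definition C_generators :: "nat \<Rightarrow> rvec set" where
  "C_generators d =
     {unit_vec i | i. 1 \<le> i \<and> i \<le> d} \<union>
     {(\<Sum>k=i..j. unit_vec k) | i j. 1 \<le> i \<and> i < j \<and> j \<le> d - 1} \<union>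
     {(\<Sum>k=i..d-1. 2 *\<^sub>R unit_vec k) + unit_vec d | i. 1 \<le> i \<and> i \<le> d - 1}"

definition C_polytope :: "nat \<Rightarrow> rvec set" where
  "C_polytope d = convex hull (C_generators d \<union> uminus ` C_generators d)"

text \<open>Interlacing with respect to the line \<open>{- 1/2 + t \<i>. t \<in> \<real>}\<close>. The sorted lists \<open>ts\<close>, \<open>ss\<close>
  hold the parameters of all roots, with multiplicity; they are determined by the polynomials.
  List positions count from 0.\<close>

definition critical_line_interlacing :: "(nat \<Rightarrow> complex poly) \<Rightarrow> bool" where
  "critical_line_interlacing f \<longleftrightarrow>
     (\<forall>d\<ge>1. \<exists>ts ss :: real list.
        length ts = d + 1 \<and> sorted ts \<and>
        proots (f (d + 1)) = mset (map (\<lambda>t. Complex (- 1 / 2) t) ts) \<and>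
        length ss = d \<and> sorted ss \<and>
        proots (f d) = mset (map (\<lambda>s. Complex (- 1 / 2) s) ss) \<and>
        (\<forall>i<d. ts ! i \<le> ss ! i \<and> ss ! i \<le> ts ! (i + 1)))"

end

theory Submission
  imports Defs
begin

text \<open>
  The polytope \<open>C\<^sub>d\<close> is the convex hull of the roots of type \<open>C\<^sub>d\<close> in coordinates with respect to
  the simple roots. The short roots are midpoints of long ones, so \<open>C\<^sub>d\<close> is a cross-polytope on
  the \<open>d\<close> long positive roots \<open>f\<^sub>i\<close>, and its dual is the parallelotope \<open>\<bar>\<langle>u, f\<^sub>i\<rangle>\<bar> \<le> 1\<close>. In the
  coordinates \<open>y\<^sub>i = \<langle>u, f\<^sub>i\<rangle>\<close> the lattice consists of the integer vectors whose entries all have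
  the same parity, so the \<open>k\<close>-th dilate contains \<open>(k + 1)\<^sup>d + k\<^sup>d\<close> lattice points.
  The zeros of \<open>(z + 1)\<^sup>d + z\<^sup>d\<close> are the points \<open>- 1/2 - (\<i>/2) cot ((2 j + 1) \<pi> / (2 d))\<close> for
  \<open>0 \<le> j < d\<close>, and they interlace because the cotangent decreases on \<open>(0, \<pi>)\<close>.
\<close>

section \<open>Coordinates\<close>

lemma lookup_scaleR:
  fixes x :: "'a \<Rightarrow>\<^sub>0 'b::real_vector"
  shows "Poly_Mapping.lookup (r *\<^sub>R x) i = r *\<^sub>R Poly_Mapping.lookup x i"
proof -
  have "finite {i. r *\<^sub>R Poly_Mapping.lookup x i \<noteq> 0}"
    by (rule finite_subset[OF _ finite_keys[of x]]) (auto simp: in_keys_iff)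
  then show ?thesis
    by (simp add: scaleR_poly_mapping_def)
qed

text \<open>The norm is the sum of the coordinate norms over the support, so it dominates each of
  them; this makes the coordinate maps continuous.\<close>

lemma norm_lookup_le:
  fixes x :: "'a \<Rightarrow>\<^sub>0 'b::real_normed_vector"
  shows "norm (Poly_Mapping.lookup x i) \<le> norm x"
proof (cases "i \<in> Poly_Mapping.keys x")
  case True
  then show ?thesis
    unfolding norm_poly_mapping_def dist_poly_mapping_def
    using member_le_sum[of i "Poly_Mapping.keys x" "\<lambda>n. norm (Poly_Mapping.lookup x n)"] by simp
qed (simp add: in_keys_iff)

lemma bounded_linear_lookup:
  "bounded_linear (\<lambda>x :: 'a \<Rightarrow>\<^sub>0 'b::real_normed_vector. Poly_Mapping.lookup x i)"
  by (rule bounded_linear_intro[of _ 1]) (auto simp: lookup_add lookup_scaleR norm_lookup_le)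

lemma mem_Rd_iff: "x \<in> Rd d \<longleftrightarrow> (\<forall>i. i \<notin> {1..d} \<longrightarrow> Poly_Mapping.lookup x i = 0)"
  by (auto simp: Rd_def in_keys_iff)

lemma subspace_Rd: "subspace (Rd d)"
  by (auto simp: subspace_def mem_Rd_iff lookup_add lookup_scaleR)

lemma uminus_Zd: "x \<in> Zd d \<Longrightarrow> - x \<in> Zd d"
  by (auto simp: Zd_def mem_Rd_iff)

lemma lookup_unit_vec: "Poly_Mapping.lookup (unit_vec i) k = (if k = i then 1 else 0)"
  by (simp add: unit_vec_def lookup_single when_def)

lemma dot_commute: "dot d u v = dot d v u"
  by (simp add: dot_def mult.commute)

lemma linear_dot_left: "linear (\<lambda>u. dot d u v)"
  by (rule linearI)
    (simp_all add: dot_def lookup_add lookup_scaleR algebra_simps sum.distrib sum_distrib_left)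

lemma linear_dot_right: "linear (dot d u)"
  using linear_dot_left[of d u] by (simp add: dot_commute[of d _ u])

lemma continuous_on_dot_left: "continuous_on S (\<lambda>u. dot d u v)"
  unfolding dot_def
  by (intro continuous_intros bounded_linear.continuous_on[OF bounded_linear_lookup])

lemma dot_unit_vec: "k \<in> {1..d} \<Longrightarrow> dot d (unit_vec k) w = Poly_Mapping.lookup w k"
  by (simp add: dot_def lookup_unit_vec if_distrib[of "\<lambda>x. x * _"] sum.delta' cong: if_cong)

lemma unit_vec_Rd: "k \<in> {1..d} \<Longrightarrow> unit_vec k \<in> Rd d"
  by (simp add: mem_Rd_iff lookup_unit_vec)

section \<open>Parallelotopes and cross-polytopes\<close>

text \<open>Induction on the number \<open>n\<close> of coefficients other than -1 and 1. A point
  with such a coefficient \<open>y j\<close> lies on the segment between the points obtained by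
  moving \<open>y j\<close> to -1 and to 1.\<close>

lemma parallelotope_eq_convex_hull:
  fixes g :: "'i \<Rightarrow> 'a::real_vector"
  assumes "finite I"
  shows "{\<Sum>i\<in>I. y i *\<^sub>R g i | y. \<forall>i\<in>I. \<bar>y i\<bar> \<le> 1} =
    convex hull ((\<lambda>s. \<Sum>i\<in>I. s i *\<^sub>R g i) ` (I \<rightarrow>\<^sub>E {-1, 1}))" (is "?P = convex hull ?V")
proof
  have *: "(\<Sum>i\<in>I. y i *\<^sub>R g i) \<in> convex hull ?V"
    if "card {i\<in>I. y i \<notin> {-1, 1}} = n" "\<forall>i\<in>I. \<bar>y i\<bar> \<le> 1" for n y
    using that
  proof (induction n arbitrary: y)
    case 0
    then have "y i \<in> {-1, 1}" if "i \<in> I" for i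
      using that assms by auto
    \<comment> \<open>The vertices are indexed by extensional sign functions, so that they are
      finite in number; hence \<open>y\<close> is cut down to \<open>I\<close>.\<close>
    then have "restrict y I \<in> I \<rightarrow>\<^sub>E {-1, 1}"
      by auto
    moreover have "(\<Sum>i\<in>I. y i *\<^sub>R g i) = (\<Sum>i\<in>I. restrict y I i *\<^sub>R g i)"
      by simp
    ultimately show ?case
      by (intro hull_inc image_eqI)
  next
    case (Suc n)
    from Suc.prems(1) obtain j where j: "j \<in> I" "y j \<notin> {-1, 1}"
      by (metis (mono_tags, lifting) card_eq_0_iff empty_Collect_eq nat.distinct(1))
    have mem: "(\<Sum>i\<in>I. (y(j := e)) i *\<^sub>R g i) \<in> convex hull ?V" if "e \<in> {-1, 1}" for e
    proof (rule Suc.IH)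
      have "{i\<in>I. y i \<notin> {-1, 1}} = insert j {i\<in>I. (y(j := e)) i \<notin> {-1, 1}}"
        using j that by auto
      then show "card {i\<in>I. (y(j := e)) i \<notin> {-1, 1}} = n"
        using Suc.prems(1) assms that by (simp split: if_splits)
      show "\<forall>i\<in>I. \<bar>(y(j := e)) i\<bar> \<le> 1"
        using Suc.prems(2) that by auto
    qed
    have split: "(\<Sum>i\<in>I. (y(j := e)) i *\<^sub>R g i) = e *\<^sub>R g j + (\<Sum>i\<in>I - {j}. y i *\<^sub>R g i)" for e
      using j assms by (subst sum.remove[of I j]) (auto intro!: sum.cong)
    let ?R = "\<Sum>i\<in>I - {j}. y i *\<^sub>R g i"
    have "(\<Sum>i\<in>I. y i *\<^sub>R g i) = y j *\<^sub>R g j + ?R"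
      using split[of "y j"] by simp
    also have "\<dots> = ((1 + y j) / 2) *\<^sub>R (1 *\<^sub>R g j + ?R) + ((1 - y j) / 2) *\<^sub>R ((-1) *\<^sub>R g j + ?R)"
    proof -
      have "(1 + y j) / 2 - (1 - y j) / 2 = y j" "(1 + y j) / 2 + (1 - y j) / 2 = 1"
        by (simp_all add: field_simps)
      then have "y j *\<^sub>R g j + 1 *\<^sub>R ?R
          = ((1 + y j) / 2 - (1 - y j) / 2) *\<^sub>R g j + ((1 + y j) / 2 + (1 - y j) / 2) *\<^sub>R ?R"
        by simp
      then show ?thesis
        unfolding scaleR_add_left scaleR_diff_left scaleR_add_right by simp
    qed
    also have "\<dots> \<in> convex hull ?V"
    proof (rule convexD[OF convex_convex_hull])
      show "1 *\<^sub>R g j + ?R \<in> convex hull ?V" "(-1) *\<^sub>R g j + ?R \<in> convex hull ?V"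
        using mem[of 1] mem[of "-1"] unfolding split by auto
      have "\<bar>y j\<bar> \<le> 1"
        using Suc.prems(2) j by blast
      then show "0 \<le> (1 + y j) / 2" "0 \<le> (1 - y j) / 2" "(1 + y j) / 2 + (1 - y j) / 2 = 1"
        by (auto simp: field_simps)
    qed
    finally show ?case .
  qed
  then show "?P \<subseteq> convex hull ?V"
    by blast
  show "convex hull ?V \<subseteq> ?P"
  proof (rule hull_minimal)
    show "?V \<subseteq> ?P"
      by (fastforce simp: PiE_iff)
    show "convex ?P"
    proof (rule convexI, safe)
      fix a b :: real and y z :: "'i \<Rightarrow> real"
      assume ab: "0 \<le> a" "0 \<le> b" "a + b = 1" and yz: "\<forall>i\<in>I. \<bar>y i\<bar> \<le> 1" "\<forall>i\<in>I. \<bar>z i\<bar> \<le> 1"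
      have "\<bar>a * y i + b * z i\<bar> \<le> 1" if "i \<in> I" for i
      proof -
        have "\<bar>a * y i + b * z i\<bar> \<le> a * \<bar>y i\<bar> + b * \<bar>z i\<bar>"
          using ab abs_triangle_ineq[of "a * y i" "b * z i"] by (simp add: abs_mult)
        also have "\<dots> \<le> a * 1 + b * 1"
          using ab yz that by (intro add_mono mult_left_mono) auto
        finally show ?thesis
          using ab by simp
      qed
      then show "\<exists>w. a *\<^sub>R (\<Sum>i\<in>I. y i *\<^sub>R g i) + b *\<^sub>R (\<Sum>i\<in>I. z i *\<^sub>R g i) = (\<Sum>i\<in>I. w i *\<^sub>R g i) \<and>
          (\<forall>i\<in>I. \<bar>w i\<bar> \<le> 1)"
        by (intro exI[of _ "\<lambda>i. a * y i + b * z i"])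
          (simp add: scaleR_sum_right scaleR_add_left sum.distrib)
    qed
  qed
qed

lemma zero_in_symmetric_convex_hull:
  fixes f :: "'i \<Rightarrow> 'a::real_vector"
  assumes "I \<noteq> {}"
  shows "0 \<in> convex hull (f ` I \<union> uminus ` f ` I)"
proof -
  obtain i where "i \<in> I"
    using assms by blast
  then have "(1/2) *\<^sub>R f i + (1/2) *\<^sub>R (- f i) \<in> convex hull (f ` I \<union> uminus ` f ` I)"
    by (intro convexD[OF convex_convex_hull] hull_inc) auto
  then show ?thesis
    by simp
qed

text \<open>If \<open>C\<close>, the sum of the absolute values, is positive, the point is
  \<open>C\<close> times a convex combination of the vectors \<open>sgn (c i) *\<^sub>R f i\<close>;
  the remaining weight \<open>1 - C\<close> goes to the origin.\<close>

lemma sum_in_cross_polytope: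
  fixes f :: "'i \<Rightarrow> 'a::real_vector"
  assumes "finite I" "I \<noteq> {}" "(\<Sum>i\<in>I. \<bar>c i\<bar>) \<le> 1"
  shows "(\<Sum>i\<in>I. c i *\<^sub>R f i) \<in> convex hull (f ` I \<union> uminus ` f ` I)" (is "_ \<in> ?H")
proof -
  let ?C = "\<Sum>i\<in>I. \<bar>c i\<bar>"
  have 0: "0 \<in> ?H"
    using assms(2) by (rule zero_in_symmetric_convex_hull)
  show ?thesis
  proof (cases "?C = 0")
    case True
    then have "\<forall>i\<in>I. c i = 0"
      using assms(1) by (subst (asm) sum_nonneg_eq_0_iff) auto
    with 0 show ?thesis
      by simp
  next
    case False
    have C: "0 < ?C"
      using False by (simp add: sum_nonneg order_less_le)
    have "(\<Sum>i\<in>I. (\<bar>c i\<bar> / ?C) *\<^sub>R (sgn (c i) *\<^sub>R f i)) \<in> ?H"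
    proof (rule convex_sum)
      show "(\<Sum>i\<in>I. \<bar>c i\<bar> / ?C) = 1"
        using C by (simp flip: sum_divide_distrib)
      fix i assume "i \<in> I"
      \<comment> \<open>A vanishing \<open>c i\<close> contributes the origin, so
        \<open>0 \<in> ?H\<close> enters here as well.\<close>
      then show "sgn (c i) *\<^sub>R f i \<in> ?H"
        using 0 by (auto simp: sgn_if intro: hull_inc)
      show "0 \<le> \<bar>c i\<bar> / ?C"
        using C by simp
    qed (use assms in auto)
    then have "?C *\<^sub>R (\<Sum>i\<in>I. (\<bar>c i\<bar> / ?C) *\<^sub>R (sgn (c i) *\<^sub>R f i)) + (1 - ?C) *\<^sub>R 0 \<in> ?H"
      using C assms(3) 0 by (intro convexD[OF convex_convex_hull]) auto
    moreover have "?C *\<^sub>R (\<Sum>i\<in>I. (\<bar>c i\<bar> / ?C) *\<^sub>R (sgn (c i) *\<^sub>R f i)) = (\<Sum>i\<in>I. c i *\<^sub>R f i)"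
      using C by (simp add: scaleR_sum_right abs_mult_sgn mult.assoc[symmetric])
    ultimately show ?thesis
      by simp
  qed
qed

text \<open>For fixed \<open>u\<close> the condition on \<open>v\<close> describes a half-space,
  which is convex, so it passes from \<open>S\<close> to its hull.\<close>

lemma dual_polytope_convex_hull:
  "dual_polytope d (convex hull S) = {u \<in> Rd d. \<forall>v\<in>S. dot d u v \<le> 1}"
proof -
  have "dot d u v \<le> 1" if "\<forall>v\<in>S. dot d u v \<le> 1" "v \<in> convex hull S" for u v
  proof -
    have "convex (dot d u -` {..1})"
      by (intro convex_linear_vimage linear_dot_right) simp
    then have "convex hull S \<subseteq> dot d u -` {..1}"
      using that by (intro hull_minimal) auto
    then show ?thesis
      using that by auto
  qed
  then show ?thesis
    by (auto simp: dual_polytope_def intro: hull_inc)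
qed

lemma span_convex_hull: "span (convex hull V) = span V"
proof
  show "span (convex hull V) \<subseteq> span V"
    by (intro span_minimal hull_minimal span_superset subspace_imp_convex subspace_span)
  show "span V \<subseteq> span (convex hull V)"
    by (intro span_mono hull_subset)
qed

text \<open>As the hull contains 0, the affine hull of \<open>V\<close> is its span; the extreme
  points of the hull belong to \<open>V\<close>.\<close>

lemma lattice_polytope_convex_hull:
  assumes "finite V" "V \<subseteq> Zd d" "0 \<in> convex hull V" "span V = Rd d"
  shows "lattice_polytope d (convex hull V)"
proof -
  have "affine hull V = Rd d"
    using affine_hull_span_0[of V] assms convex_hull_subset_affine_hull[of V] by auto
  moreover have "v \<in> V" if "v extreme_point_of convex hull V" for v
    using that by (rule extreme_point_of_convex_hull)
  ultimately show ?thesis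
    using assms by (auto simp: lattice_polytope_def polytope_def affine_hull_convex_hull)
qed

section \<open>Dual bases and the polar pair of cross-polytope and parallelotope\<close>

locale dual_bases =
  fixes d :: nat and f g :: "nat \<Rightarrow> rvec"
  assumes pos: "d > 0"
    and f_Rd: "i \<in> {1..d} \<Longrightarrow> f i \<in> Rd d"
    and g_Rd: "i \<in> {1..d} \<Longrightarrow> g i \<in> Rd d"
    and dot_g_f: "i \<in> {1..d} \<Longrightarrow> j \<in> {1..d} \<Longrightarrow> dot d (g i) (f j) = (if i = j then 1 else 0)"
    and expand_g: "u \<in> Rd d \<Longrightarrow> u = (\<Sum>i=1..d. dot d u (f i) *\<^sub>R g i)"
begin

definition cross where "cross = convex hull (f ` {1..d} \<union> uminus ` f ` {1..d})"
definition cube where "cube = {u \<in> Rd d. \<forall>i\<in>{1..d}. \<bar>dot d u (f i)\<bar> \<le> 1}"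

lemma dot_sum_g: "j \<in> {1..d} \<Longrightarrow> dot d (\<Sum>i=1..d. y i *\<^sub>R g i) (f j) = y j"
  by (simp add: linear_sum[OF linear_dot_left] linear_scale[OF linear_dot_left] dot_g_f
      if_distrib[of "\<lambda>x. _ * x"] sum.delta cong: if_cong)

lemma dot_sum_f: "j \<in> {1..d} \<Longrightarrow> dot d (g j) (\<Sum>i=1..d. c i *\<^sub>R f i) = c j"
  by (simp add: linear_sum[OF linear_dot_right] linear_scale[OF linear_dot_right] dot_g_f
      if_distrib[of "\<lambda>x. _ * x"] sum.delta' cong: if_cong)

lemma sum_f_Rd: "(\<Sum>i=1..d. c i *\<^sub>R f i) \<in> Rd d"
  by (intro subspace_sum subspace_scale subspace_Rd f_Rd)

lemma sum_g_Rd: "(\<Sum>i=1..d. y i *\<^sub>R g i) \<in> Rd d"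
  by (intro subspace_sum subspace_scale subspace_Rd g_Rd)

lemma dot_expand:
  assumes "u \<in> Rd d"
  shows "dot d u v = (\<Sum>i=1..d. dot d u (f i) * dot d (g i) v)"
proof -
  have "dot d u v = dot d (\<Sum>i=1..d. dot d u (f i) *\<^sub>R g i) v"
    using expand_g[OF assms] by simp
  then show ?thesis
    by (simp add: linear_sum[OF linear_dot_left] linear_scale[OF linear_dot_left])
qed

text \<open>The error \<open>w\<close> of the expansion is orthogonal to every \<open>g j\<close>.
  Expanding the unit vectors in the basis \<open>g\<close> then shows that every coordinate of
  \<open>w\<close> vanishes.\<close>

lemma expand_f:
  assumes "v \<in> Rd d"
  shows "v = (\<Sum>i=1..d. dot d (g i) v *\<^sub>R f i)"
proof -
  define w where "w = v - (\<Sum>i=1..d. dot d (g i) v *\<^sub>R f i)"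
  have w: "w \<in> Rd d"
    unfolding w_def by (intro subspace_diff subspace_Rd assms sum_f_Rd)
  have "dot d (g j) w = 0" if "j \<in> {1..d}" for j
    unfolding w_def linear_diff[OF linear_dot_right] dot_sum_f[OF that] by simp
  then have "Poly_Mapping.lookup w k = 0" if "k \<in> {1..d}" for k
    using dot_expand[OF unit_vec_Rd[OF that], of w] that by (simp add: dot_unit_vec)
  with w have "w = 0"
    by (intro poly_mapping_eqI) (auto simp: mem_Rd_iff)
  then show ?thesis
    by (simp add: w_def)
qed

lemma dual_cross: "dual_polytope d cross = cube"
  unfolding cross_def dual_polytope_convex_hull cube_def
  by (auto simp: linear_neg[OF linear_dot_right] abs_le_iff ball_Un image_image)

lemma cube_eq_sums: "cube = {\<Sum>i=1..d. y i *\<^sub>R g i | y. \<forall>i\<in>{1..d}. \<bar>y i\<bar> \<le> 1}"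
proof safe
  fix u assume "u \<in> cube"
  then show "\<exists>y. u = (\<Sum>i=1..d. y i *\<^sub>R g i) \<and> (\<forall>i\<in>{1..d}. \<bar>y i\<bar> \<le> 1)"
    using expand_g[of u] by (intro exI[of _ "\<lambda>i. dot d u (f i)"]) (simp add: cube_def)
next
  fix y :: "nat \<Rightarrow> real" assume "\<forall>i\<in>{1..d}. \<bar>y i\<bar> \<le> 1"
  then show "(\<Sum>i=1..d. y i *\<^sub>R g i) \<in> cube"
    unfolding cube_def using sum_g_Rd by (simp add: dot_sum_g del: One_nat_def)
qed

lemma cube_eq_convex_hull:
  "cube = convex hull ((\<lambda>s. \<Sum>i=1..d. s i *\<^sub>R g i) ` ({1..d} \<rightarrow>\<^sub>E {-1, 1}))"
  unfolding cube_eq_sums by (rule parallelotope_eq_convex_hull) simp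

text \<open>Testing \<open>v\<close> against the point of the cube whose coefficients are the signs
  of \<open>dot d (g i) v\<close> gives that the absolute values of these numbers sum to at most 1.
  They are the coefficients of \<open>v\<close> in the basis \<open>f\<close>, so \<open>v\<close>
  lies in the cross-polytope.\<close>

lemma dual_cube: "dual_polytope d cube = cross"
proof
  show "dual_polytope d cube \<subseteq> cross"
  proof
    fix v assume v: "v \<in> dual_polytope d cube"
    then have vR: "v \<in> Rd d"
      by (simp add: dual_polytope_def)
    let ?u = "\<Sum>i=1..d. sgn (dot d (g i) v) *\<^sub>R g i"
    have "?u \<in> cube"
      unfolding cube_eq_sums by (auto simp: sgn_if intro!: exI[of _ "\<lambda>i. sgn (dot d (g i) v)"])
    then have "dot d v ?u \<le> 1"
      using v by (simp add: dual_polytope_def)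
    then have "(\<Sum>i=1..d. \<bar>dot d (g i) v\<bar>) \<le> 1"
      by (simp add: linear_sum[OF linear_dot_right] linear_scale[OF linear_dot_right]
          dot_commute[of d v] sgn_mult_self_eq abs_sgn mult.commute)
    then show "v \<in> cross"
      unfolding cross_def using sum_in_cross_polytope[of "{1..d}" "\<lambda>i. dot d (g i) v" f]
        expand_f[OF vR] pos by auto
  qed
  show "cross \<subseteq> dual_polytope d cube"
  proof
    fix v assume v: "v \<in> cross"
    have "cross \<subseteq> Rd d"
      unfolding cross_def
      by (rule hull_minimal) (auto intro!: f_Rd subspace_neg subspace_Rd subspace_imp_convex)
    moreover have "dot d v u \<le> 1" if "u \<in> cube" for u
      using that v unfolding dual_cross[symmetric] by (auto simp: dual_polytope_def dot_commute)
    ultimately show "v \<in> dual_polytope d cube"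
      using v by (auto simp: dual_polytope_def)
  qed
qed

lemma span_cross: "span (f ` {1..d} \<union> uminus ` f ` {1..d}) = Rd d"
proof
  show "span (f ` {1..d} \<union> uminus ` f ` {1..d}) \<subseteq> Rd d"
    by (rule span_minimal) (auto intro!: f_Rd subspace_neg subspace_Rd)
  show "Rd d \<subseteq> span (f ` {1..d} \<union> uminus ` f ` {1..d})"
  proof
    fix v assume "v \<in> Rd d"
    then show "v \<in> span (f ` {1..d} \<union> uminus ` f ` {1..d})"
      by (subst expand_f) (auto intro!: span_sum span_scale intro: span_base)
  qed
qed

lemma span_cube: "span cube = Rd d"
proof
  show "span cube \<subseteq> Rd d"
    by (rule span_minimal[OF _ subspace_Rd]) (auto simp: cube_def)
  have "g i \<in> cube" if "i \<in> {1..d}" for i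
    using that by (simp add: cube_def g_Rd dot_g_f)
  then show "Rd d \<subseteq> span cube"
    using expand_g by (metis (no_types, lifting) span_base span_scale span_sum subsetI)
qed

lemma zero_in_cube: "0 \<in> cube"
  by (simp add: cube_def subspace_0 subspace_Rd linear_0[OF linear_dot_left])

text \<open>The strict versions of the defining inequalities cut out a relatively open subset of the
  cube that contains 0.\<close>

lemma zero_in_interior_cube: "0 \<in> top_of_set (Rd d) interior_of cube"
proof -
  let ?U = "\<Inter>i\<in>{1..d}. {u. \<bar>dot d u (f i)\<bar> < 1}"
  have "open ?U"
    by (intro open_INT ballI open_Collect_less continuous_intros continuous_on_dot_left) auto
  then have "openin (top_of_set (Rd d)) (Rd d \<inter> ?U)"
    by (rule openin_open_Int)
  moreover have "Rd d \<inter> ?U \<subseteq> cube"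
    by (auto simp: cube_def intro: less_imp_le)
  moreover have "0 \<in> Rd d \<inter> ?U"
    by (simp add: subspace_0 subspace_Rd linear_0[OF linear_dot_left])
  ultimately show ?thesis
    using interior_of_maximal by blast
qed

text \<open>The extreme points of \<open>cross\<close> are among the vectors \<open>f i\<close> and
  \<open>- f i\<close>, those of \<open>cube\<close> among the sign combinations of the
  \<open>g i\<close>. Integrality is asked of these combinations because the single vectors
  \<open>g i\<close> are in general not integral in the application.\<close>

lemma reflexive_cube:
  assumes f: "\<And>i. i \<in> {1..d} \<Longrightarrow> f i \<in> Zd d"
    and g: "\<And>s. \<forall>i\<in>{1..d}. s i \<in> {-1, 1} \<Longrightarrow> (\<Sum>i=1..d. s i *\<^sub>R g i) \<in> Zd d"
  shows "reflexive_polytope d cube"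
proof -
  have "lattice_polytope d cube"
    unfolding cube_eq_convex_hull
  proof (rule lattice_polytope_convex_hull)
    show "span ((\<lambda>s. \<Sum>i=1..d. s i *\<^sub>R g i) ` ({1..d} \<rightarrow>\<^sub>E {-1, 1})) = Rd d"
      using span_cube unfolding cube_eq_convex_hull span_convex_hull .
    show "(\<lambda>s. \<Sum>i=1..d. s i *\<^sub>R g i) ` ({1..d} \<rightarrow>\<^sub>E {-1, 1}) \<subseteq> Zd d"
      using g by (auto simp: PiE_iff)
  qed (use zero_in_cube cube_eq_convex_hull in \<open>auto intro!: finite_imageI finite_PiE\<close>)
  moreover have "lattice_polytope d cross"
    unfolding cross_def
    by (rule lattice_polytope_convex_hull)
      (use span_cross zero_in_symmetric_convex_hull[of "{1..d}" f] pos f uminus_Zd in auto)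
  ultimately show ?thesis
    unfolding reflexive_polytope_def dual_cube using zero_in_interior_cube by simp
qed

lemma dilated_cube:
  assumes "k > 0"
  shows "(*\<^sub>R) k ` cube = {u \<in> Rd d. \<forall>i\<in>{1..d}. \<bar>dot d u (f i)\<bar> \<le> k}"
proof safe
  fix u assume u: "u \<in> cube"
  then show "k *\<^sub>R u \<in> Rd d"
    by (auto simp: cube_def intro: subspace_scale subspace_Rd)
  show "\<bar>dot d (k *\<^sub>R u) (f i)\<bar> \<le> k" if "i \<in> {1..d}" for i
    using u that assms by (simp add: cube_def linear_scale[OF linear_dot_left] abs_mult)
next
  fix u assume u: "u \<in> Rd d" "\<forall>i\<in>{1..d}. \<bar>dot d u (f i)\<bar> \<le> k"
  then have "(1 / k) *\<^sub>R u \<in> cube"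
    using assms by (auto simp: cube_def linear_scale[OF linear_dot_left] abs_mult field_simps
        intro: subspace_scale subspace_Rd)
  then show "u \<in> (*\<^sub>R) k ` cube"
    using assms by (intro image_eqI[of _ _ "(1 / k) *\<^sub>R u"]) auto
qed

end

section \<open>The root polytope of type C\<close>

text \<open>In the basis \<open>e\<^sub>1, \<dots>, e\<^sub>d\<close> of simple roots of type \<open>C\<^sub>d\<close>, these are the long positive
  roots \<open>2 \<epsilon>\<^sub>i\<close>; the short roots \<open>\<plusminus> \<epsilon>\<^sub>i \<plusminus> \<epsilon>\<^sub>j\<close> are midpoints of long ones.\<close>

definition long_root :: "nat \<Rightarrow> nat \<Rightarrow> rvec" where
  "long_root d i = (\<Sum>k=i..d-1. 2 *\<^sub>R unit_vec k) + unit_vec d"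

text \<open>The basis dual to the long roots: vectors are read as functionals, and this one is half
  the coordinate functional of \<open>\<epsilon>\<^sub>i\<close>. The index \<open>d\<close> is
  special because the simple root \<open>unit_vec d\<close> is itself long; for \<open>i = 1\<close>
  there is no preceding coordinate.\<close>

definition half_coweight :: "nat \<Rightarrow> nat \<Rightarrow> rvec" where
  "half_coweight d i = (if i = d then unit_vec d else (1/2) *\<^sub>R unit_vec i) -
     (if 2 \<le> i then (1/2) *\<^sub>R unit_vec (i - 1) else 0)"

context
  fixes d :: nat
  assumes d_pos: "d > 0"
begin

lemma lookup_long_root:
  "Poly_Mapping.lookup (long_root d i) k = (if k = d then 1 else if i \<le> k \<and> k < d then 2 else 0)"
  using d_pos by (auto simp: long_root_def lookup_add lookup_sum lookup_scaleR lookup_unit_vec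
      if_distrib[of "\<lambda>x. 2 * x"] sum.delta cong: if_cong)

text \<open>For integral \<open>u\<close> all these pairings have the parity of the last coordinate.
  This is one half of the same-parity description of the lattice.\<close>

lemma dot_long_root:
  assumes "i \<in> {1..d}"
  shows "dot d u (long_root d i) =
    2 * (\<Sum>k=i..<d. Poly_Mapping.lookup u k) + Poly_Mapping.lookup u d"
proof -
  have "dot d u (unit_vec k) = Poly_Mapping.lookup u k" if "k \<in> {1..d}" for k
    using dot_unit_vec[OF that] by (simp add: dot_commute)
  moreover have "{i..d-1} = {i..<d}"
    using d_pos by auto
  ultimately show ?thesis
    using assms d_pos
    by (simp add: long_root_def linear_add[OF linear_dot_right] linear_sum[OF linear_dot_right]
        linear_scale[OF linear_dot_right] sum_distrib_left)
qed

lemma long_root_Zd: "i \<in> {1..d} \<Longrightarrow> long_root d i \<in> Zd d"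
  using d_pos by (auto simp: Zd_def mem_Rd_iff lookup_long_root)

lemma half_coweight_Rd: "i \<in> {1..d} \<Longrightarrow> half_coweight d i \<in> Rd d"
  unfolding half_coweight_def
  by (auto simp: mem_Rd_iff lookup_minus lookup_scaleR lookup_unit_vec)

lemma dot_half_coweight:
  assumes "i \<in> {1..d}"
  shows "dot d (half_coweight d i) v =
    (if i = d then Poly_Mapping.lookup v d else Poly_Mapping.lookup v i / 2) -
    (if 2 \<le> i then Poly_Mapping.lookup v (i - 1) / 2 else 0)"
proof -
  have "dot d (unit_vec (i - 1)) v = Poly_Mapping.lookup v (i - 1)" if "2 \<le> i"
    using that assms by (intro dot_unit_vec) auto
  then show ?thesis
    using assms by (auto simp: half_coweight_def linear_diff[OF linear_dot_left]
        linear_scale[OF linear_dot_left] linear_0[OF linear_dot_left] dot_unit_vec)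
qed

text \<open>Only the summands with index \<open>k\<close> and \<open>Suc k\<close> meet coordinate
  \<open>k\<close>. For integer \<open>y\<close> the halved difference is integral exactly when the
  two entries have the same parity.\<close>

lemma lookup_sum_half_coweight:
  assumes "k \<in> {1..d}"
  shows "Poly_Mapping.lookup (\<Sum>i=1..d. y i *\<^sub>R half_coweight d i) k =
    (if k = d then y d else (y k - y (Suc k)) / 2)"
proof -
  have "y i * Poly_Mapping.lookup (half_coweight d i) k =
      (if i = k then (if k = d then y d else y k / 2) else 0) -
      (if i = Suc k then y (Suc k) / 2 else 0)" if "i \<in> {1..d}" for i
    using that assms
    by (auto simp: half_coweight_def lookup_minus lookup_scaleR lookup_unit_vec)
  then have "Poly_Mapping.lookup (\<Sum>i=1..d. y i *\<^sub>R half_coweight d i) k =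
      (\<Sum>i=1..d. (if i = k then (if k = d then y d else y k / 2) else 0) -
        (if i = Suc k then y (Suc k) / 2 else 0))"
    unfolding lookup_sum lookup_scaleR real_scaleR_def by (rule sum.cong[OF refl])
  also have "\<dots> = (if k = d then y d else (y k - y (Suc k)) / 2)"
    using assms by (auto simp: sum_subtractf sum.delta diff_divide_distrib)
  finally show ?thesis .
qed

lemma dual_bases_C: "dual_bases d (long_root d) (half_coweight d)"
proof
  show "0 < d"
    by (rule d_pos)
  show "long_root d i \<in> Rd d" if "i \<in> {1..d}" for i
    using long_root_Zd[OF that] by (simp add: Zd_def)
  show g: "half_coweight d i \<in> Rd d" if "i \<in> {1..d}" for i
    using that by (rule half_coweight_Rd)
  show "dot d (half_coweight d i) (long_root d j) = (if i = j then 1 else 0)"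
    if "i \<in> {1..d}" "j \<in> {1..d}" for i j
    unfolding dot_half_coweight[OF that(1)] lookup_long_root using that by auto
  show "u = (\<Sum>i=1..d. dot d u (long_root d i) *\<^sub>R half_coweight d i)" (is "_ = ?s")
    if u: "u \<in> Rd d" for u
  proof (rule poly_mapping_eqI)
    fix k
    have s: "?s \<in> Rd d"
      by (intro subspace_sum subspace_scale subspace_Rd g)
    show "Poly_Mapping.lookup u k = Poly_Mapping.lookup ?s k"
    proof (cases "k \<in> {1..d}")
      case True
      show ?thesis
        unfolding lookup_sum_half_coweight[OF True] using True
        \<comment> \<open>The pairings with consecutive long roots differ by twice the coordinate
          \<open>k\<close>; for \<open>k = d\<close> the sum in the pairing is empty.\<close>
        by (auto simp: dot_long_root sum.atLeast_Suc_lessThan)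
    qed (use u s in \<open>auto simp: mem_Rd_iff\<close>)
  qed
qed

interpretation C: dual_bases d "long_root d" "half_coweight d"
  by (rule dual_bases_C)

text \<open>The left side is the short root \<epsilon>_i - \<epsilon>_(j+1), the midpoint of the
  long roots 2 \<epsilon>_i and - 2 \<epsilon>_(j+1).\<close>

lemma sum_unit_vec_eq_midpoint:
  assumes "1 \<le> i" "i \<le> j" "j < d"
  shows "(\<Sum>k=i..j. unit_vec k) = (1/2) *\<^sub>R long_root d i + (1/2) *\<^sub>R (- long_root d (Suc j))"
proof (rule poly_mapping_eqI)
  fix k
  have "Poly_Mapping.lookup (\<Sum>k=i..j. unit_vec k) k = (if k \<in> {i..j} then 1 else 0)"
    by (simp add: lookup_sum lookup_unit_vec)
  then show "Poly_Mapping.lookup (\<Sum>k=i..j. unit_vec k) k =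
      Poly_Mapping.lookup ((1/2) *\<^sub>R long_root d i + (1/2) *\<^sub>R (- long_root d (Suc j))) k"
    unfolding lookup_add lookup_scaleR lookup_uminus lookup_long_root using assms by auto
qed

text \<open>The generators that are not long roots are midpoints of vertices of the symmetric
  cross-polytope, and conversely every long root is a generator.\<close>

lemma C_polytope_eq_cross: "C_polytope d = C.cross"
proof
  have neg: "uminus ` C.cross = C.cross"
    unfolding C.cross_def
    by (subst convex_hull_linear_image) (auto simp: image_Un image_image Un_commute
        intro: linear_uminus)
  have roots: "long_root d i \<in> C.cross" "- long_root d i \<in> C.cross" if "i \<in> {1..d}" for i
    using that unfolding C.cross_def by (auto intro: hull_inc)
  have mid: "(\<Sum>k=i..j. unit_vec k) \<in> C.cross" if "1 \<le> i" "i \<le> j" "j < d" for i j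
  proof -
    have "convex C.cross"
      unfolding C.cross_def by (rule convex_convex_hull)
    then show ?thesis
      unfolding sum_unit_vec_eq_midpoint[OF that] using that
      by (intro convexD roots) auto
  qed
  have "unit_vec i \<in> C.cross" if "1 \<le> i" "i \<le> d" for i
  proof (cases "i = d")
    case True
    then show ?thesis
      using roots(1)[of d] d_pos by (simp add: long_root_def)
  next
    case False
    then show ?thesis
      using mid[of i i] that by simp
  qed
  then have gen: "C_generators d \<subseteq> C.cross"
    using mid roots(1) unfolding C_generators_def long_root_def[symmetric] by auto
  then have "uminus ` C_generators d \<subseteq> C.cross"
    using neg by blast
  with gen show "C_polytope d \<subseteq> C.cross"
    unfolding C_polytope_def by (intro hull_minimal) (auto simp: C.cross_def)
  have "long_root d i \<in> C_generators d" if "i \<in> {1..d}" for i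
  \<comment> \<open>The last long root is \<open>unit_vec d\<close>, found among the unit vectors;
    the third family stops at \<open>d - 1\<close>.\<close>
  proof (cases "i = d")
    case True
    then have "long_root d i = unit_vec d"
      using d_pos by (simp add: long_root_def)
    moreover have "unit_vec d \<in> {unit_vec i | i. 1 \<le> i \<and> i \<le> d}"
      using d_pos by force
    ultimately show ?thesis
      unfolding C_generators_def by simp
  next
    case False
    then have "1 \<le> i \<and> i \<le> d - 1"
      using that by auto
    then have "long_root d i \<in> {long_root d i | i. 1 \<le> i \<and> i \<le> d - 1}"
      by blast
    then show ?thesis
      unfolding C_generators_def long_root_def by (rule UnI2)
  qed
  then show "C.cross \<subseteq> C_polytope d"
    unfolding C_polytope_def C.cross_def by (intro hull_mono) blast
qed

lemma dual_C_polytope: "dual_polytope d (C_polytope d) = C.cube"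
  unfolding C_polytope_eq_cross by (rule C.dual_cross)

lemma sum_half_coweight_Zd:
  fixes n :: "nat \<Rightarrow> int"
  assumes "\<And>i j. i \<in> {1..d} \<Longrightarrow> j \<in> {1..d} \<Longrightarrow> even (n i) = even (n j)"
  shows "(\<Sum>i=1..d. real_of_int (n i) *\<^sub>R half_coweight d i) \<in> Zd d"
  unfolding Zd_def
proof (intro CollectI conjI allI C.sum_g_Rd)
  fix k
  show "Poly_Mapping.lookup (\<Sum>i=1..d. real_of_int (n i) *\<^sub>R half_coweight d i) k \<in> \<int>"
  proof (cases "k \<in> {1..d}")
    case True
    have "(real_of_int (n k) - real_of_int (n (Suc k))) / 2 \<in> \<int>" if "k \<noteq> d"
    proof -
      have "even (n k - n (Suc k))"
        using assms[of k "Suc k"] True that by auto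
      then obtain m where "n k - n (Suc k) = 2 * m"
        by (rule evenE)
      then have "(real_of_int (n k) - real_of_int (n (Suc k))) / 2 = real_of_int m"
        by (simp flip: of_int_diff)
      then show ?thesis
        by simp
    qed
    then show ?thesis
      unfolding lookup_sum_half_coweight[OF True] by auto
  next
    case False
    then show ?thesis
      using C.sum_g_Rd[of "\<lambda>i. real_of_int (n i)"] by (simp add: mem_Rd_iff)
  qed
qed

text \<open>The coefficients of the vertices are all -1 or 1, hence all odd, so the vertices satisfy
  the parity condition.\<close>

lemma reflexive_dual_C_polytope: "reflexive_polytope d (dual_polytope d (C_polytope d))"
  unfolding dual_C_polytope
proof (rule C.reflexive_cube)
  fix s :: "nat \<Rightarrow> real" assume s: "\<forall>i\<in>{1..d}. s i \<in> {-1, 1}"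
  then have "s i = real_of_int \<lfloor>s i\<rfloor>" if "i \<in> {1..d}" for i
    using that by force
  then have "(\<Sum>i=1..d. s i *\<^sub>R half_coweight d i) =
      (\<Sum>i=1..d. real_of_int \<lfloor>s i\<rfloor> *\<^sub>R half_coweight d i)"
    by (intro sum.cong) auto
  moreover have "odd \<lfloor>s i\<rfloor>" if "i \<in> {1..d}" for i
  proof -
    from s that have "s i = - 1 \<or> s i = 1"
      by blast
    then show ?thesis
      by (elim disjE) (simp_all add: floor_minus)
  qed
  ultimately show "(\<Sum>i=1..d. s i *\<^sub>R half_coweight d i) \<in> Zd d"
    using sum_half_coweight_Zd[of "\<lambda>i. \<lfloor>s i\<rfloor>"] by simp
qed (rule long_root_Zd)

end

section \<open>Counting the lattice points of the dilates\<close>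

lemma card_same_parity_interval:
  "card {y::int. \<bar>y\<bar> \<le> int k \<and> even (y + int k)} = k + 1"
proof -
  have "{y::int. \<bar>y\<bar> \<le> int k \<and> even (y + int k)} = (\<lambda>j. 2 * int j - int k) ` {..k}"
  proof safe
    fix y :: int assume y: "\<bar>y\<bar> \<le> int k" "even (y + int k)"
    then obtain m where "y + int k = 2 * m"
      by (elim evenE)
    with y show "y \<in> (\<lambda>j. 2 * int j - int k) ` {..k}"
      by (intro image_eqI[of _ _ "nat m"]) auto
  qed auto
  then show ?thesis
    by (simp add: card_image inj_on_def)
qed

lemma card_opposite_parity_interval:
  "card {y::int. \<bar>y\<bar> \<le> int k \<and> odd (y + int k)} = k"
proof -
  have "{y::int. \<bar>y\<bar> \<le> int k \<and> odd (y + int k)} = (\<lambda>j. 2 * int j + 1 - int k) ` {..<k}"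
  proof safe
    fix y :: int assume y: "\<bar>y\<bar> \<le> int k" "odd (y + int k)"
    then obtain m where "y + int k = 2 * m + 1"
      by (elim oddE)
    with y show "y \<in> (\<lambda>j. 2 * int j + 1 - int k) ` {..<k}"
      by (intro image_eqI[of _ _ "nat m"]) auto
  qed auto
  then show ?thesis
    by (simp add: card_image inj_on_def)
qed

text \<open>The map \<open>\<Phi>\<close> is a bijection from the same-parity integer vectors with
  entries in [-k, k] to the lattice points. Parity is measured relative to \<open>k\<close>: vectors
  over \<open>A\<close> number \<open>(k + 1) ^ d\<close>, those over \<open>B\<close> number
  \<open>k ^ d\<close>.\<close>

lemma card_dilated_dual_C_polytope:
  assumes d: "d > 0" and k: "k > 0"
  shows "card ((\<lambda>\<alpha>. real k *\<^sub>R \<alpha>) ` dual_polytope d (C_polytope d) \<inter> Zd d) = (k + 1) ^ d + k ^ d"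
proof -
  interpret C: dual_bases d "long_root d" "half_coweight d"
    using d by (rule dual_bases_C)
  define A where "A = {y::int. \<bar>y\<bar> \<le> int k \<and> even (y + int k)}"
  define B where "B = {y::int. \<bar>y\<bar> \<le> int k \<and> odd (y + int k)}"
  define T where "T = ({1..d} \<rightarrow>\<^sub>E A) \<union> ({1..d} \<rightarrow>\<^sub>E B)"
  define \<Phi> where "\<Phi> y = (\<Sum>i=1..d. real_of_int (y i) *\<^sub>R half_coweight d i)" for y
  have dot: "dot d (\<Phi> y) (long_root d i) = real_of_int (y i)" if "i \<in> {1..d}" for y i
    unfolding \<Phi>_def using that by (rule C.dot_sum_g)
  have dilated: "(\<lambda>\<alpha>. real k *\<^sub>R \<alpha>) ` dual_polytope d (C_polytope d) =
      {u \<in> Rd d. \<forall>i\<in>{1..d}. \<bar>dot d u (long_root d i)\<bar> \<le> real k}"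
    unfolding dual_C_polytope[OF d] using k by (intro C.dilated_cube) simp
  have "(\<lambda>\<alpha>. real k *\<^sub>R \<alpha>) ` dual_polytope d (C_polytope d) \<inter> Zd d = \<Phi> ` T"
    unfolding dilated
  proof safe
    fix u assume u: "u \<in> Zd d" "u \<in> Rd d" "\<forall>i\<in>{1..d}. \<bar>dot d u (long_root d i)\<bar> \<le> real k"
    define m where "m i = \<lfloor>Poly_Mapping.lookup u i\<rfloor>" for i
    have m: "Poly_Mapping.lookup u i = real_of_int (m i)" for i
      using u(1) by (auto simp: Zd_def m_def)
    define y where "y = (\<lambda>i\<in>{1..d}. 2 * (\<Sum>k=i..<d. m k) + m d)"
    have y: "dot d u (long_root d i) = real_of_int (y i)" if "i \<in> {1..d}" for i
      unfolding dot_long_root[OF d that] m using that by (simp add: y_def)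
    have "\<bar>y i\<bar> \<le> int k \<and> even (y i) = even (m d)" if "i \<in> {1..d}" for i
    proof
      have "\<bar>real_of_int (y i)\<bar> \<le> real k"
        using u(3) y that by metis
      then show "\<bar>y i\<bar> \<le> int k"
        by linarith
      show "even (y i) = even (m d)"
        using that by (simp add: y_def)
    qed
    then have "y \<in> T"
      by (cases "even (m d + int k)") (auto simp: T_def A_def B_def PiE_iff y_def)
    moreover have "u = \<Phi> y"
      unfolding \<Phi>_def by (subst C.expand_g[OF u(2)]) (simp add: y)
    ultimately show "u \<in> \<Phi> ` T"
      by blast
  next
    fix y assume y: "y \<in> T"
    show "\<Phi> y \<in> Zd d"
      unfolding \<Phi>_def
    proof (rule sum_half_coweight_Zd[OF d])
      show "even (y i) = even (y j)" if "i \<in> {1..d}" "j \<in> {1..d}" for i j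
        using y that by (auto simp: T_def A_def B_def PiE_iff)
    qed
    then show "\<Phi> y \<in> Rd d"
      by (simp add: Zd_def)
    have "\<bar>y i\<bar> \<le> int k" if "i \<in> {1..d}" for i
      using y that by (auto simp: T_def A_def B_def PiE_iff)
    then show "\<bar>dot d (\<Phi> y) (long_root d i)\<bar> \<le> real k" if "i \<in> {1..d}" for i
      using that unfolding dot[OF that] by (metis of_int_abs of_int_le_iff of_int_of_nat_eq)
  qed
  moreover have "inj_on \<Phi> T"
  proof (rule inj_onI)
    fix y z assume "y \<in> T" "z \<in> T" and eq: "\<Phi> y = \<Phi> z"
    then have "y \<in> extensional {1..d}" "z \<in> extensional {1..d}"
      by (auto simp: T_def PiE_def)
    moreover have "y i = z i" if "i \<in> {1..d}" for i
      using dot[OF that, of y] dot[OF that, of z] eq by simp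
    ultimately show "y = z"
      by (rule extensionalityI)
  qed
  moreover have "card T = (k + 1) ^ d + k ^ d"
  proof -
    have "A \<subseteq> {- int k..int k}" "B \<subseteq> {- int k..int k}"
      by (auto simp: A_def B_def)
    then have fin: "finite A" "finite B"
      using finite_subset finite_atLeastAtMost_int by metis+
    \<comment> \<open>Since \<open>d\<close> is positive, a common vector would have a first entry
      of both parities.\<close>
    have "y 1 \<in> A \<inter> B" if "y \<in> ({1..d} \<rightarrow>\<^sub>E A) \<inter> ({1..d} \<rightarrow>\<^sub>E B)" for y
      using that d by auto
    then have "({1..d} \<rightarrow>\<^sub>E A) \<inter> ({1..d} \<rightarrow>\<^sub>E B) = {}"
      unfolding A_def B_def by blast
    then have "card T = card ({1..d} \<rightarrow>\<^sub>E A) + card ({1..d} \<rightarrow>\<^sub>E B)"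
      unfolding T_def using fin by (intro card_Un_disjoint finite_PiE) auto
    then show ?thesis
      using card_same_parity_interval[of k, folded A_def]
        card_opposite_parity_interval[of k, folded B_def]
      by (simp add: card_PiE)
  qed
  ultimately show ?thesis
    by (simp add: card_image)
qed

section \<open>The Ehrhart polynomial and its roots\<close>

definition power_sum_poly :: "nat \<Rightarrow> complex poly" where
  "power_sum_poly d = [:1, 1:] ^ d + [:0, 1:] ^ d"

lemma poly_power_sum_poly: "poly (power_sum_poly d) z = (z + 1) ^ d + z ^ d"
  by (simp add: power_sum_poly_def add.commute)

text \<open>Both summands are monic of degree \<open>d\<close>, so the leading coefficients add up
  to 2 and nothing cancels.\<close>

lemma degree_power_sum_poly: "degree (power_sum_poly d) = d"
proof (rule antisym)
  show "degree (power_sum_poly d) \<le> d"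
    unfolding power_sum_poly_def
    by (intro degree_add_le) (simp_all add: degree_linear_power)
  have "coeff (power_sum_poly d) d = 2"
    by (simp add: power_sum_poly_def coeff_linear_power)
  then show "d \<le> degree (power_sum_poly d)"
    by (intro le_degree) simp
qed

lemma ehrhart_poly_dual_C_polytope:
  assumes "d > 0"
  shows "ehrhart_poly d (dual_polytope d (C_polytope d)) = power_sum_poly d"
proof -
  have "is_ehrhart_poly d (dual_polytope d (C_polytope d)) (power_sum_poly d)"
    using assms by (simp add: is_ehrhart_poly_def degree_power_sum_poly poly_power_sum_poly
        card_dilated_dual_C_polytope add.commute)
  then show ?thesis
    unfolding ehrhart_poly_def using is_ehrhart_poly_unique by (intro the_equality)
qed

section \<open>The zeros on the critical line\<close>

text \<open>The minus sign makes the values increase with \<open>j\<close>, as the sorted lists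
  require.\<close>

definition critical_root :: "nat \<Rightarrow> nat \<Rightarrow> real" where
  "critical_root d j = - cot (real (2 * j + 1) * pi / real (2 * d)) / 2"

lemma angle_in_range:
  assumes "j < d"
  shows "0 < real (2 * j + 1) * pi / real (2 * d)" "real (2 * j + 1) * pi / real (2 * d) < pi"
proof -
  have "real (2 * j + 1) * pi < real (2 * d) * pi"
    using assms by (intro mult_strict_right_mono) auto
  then show "real (2 * j + 1) * pi / real (2 * d) < pi"
    using assms by (simp add: divide_less_eq mult.commute)
  show "0 < real (2 * j + 1) * pi / real (2 * d)"
    using assms by simp
qed

lemma cot_strict_antimono:
  assumes "0 < x" "x < y" "y < pi"
  shows "cot y < cot x"
proof -
  have "0 < sin (y - x)" "0 < sin x" "0 < sin y"
    using assms by (auto intro: sin_gt_zero)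
  moreover from this have "cot x - cot y = sin (y - x) / (sin x * sin y)"
    by (simp add: cot_def sin_diff field_simps)
  ultimately have "0 < cot x - cot y"
    by simp
  then show ?thesis
    by simp
qed

text \<open>The last hypothesis compares the two angles after clearing denominators. Equal
  dimensions give distinctness and sortedness, consecutive ones the interlacing.\<close>

lemma critical_root_less:
  assumes "i < d" "j < e" "(2 * i + 1) * e < (2 * j + 1) * d"
  shows "critical_root d i < critical_root e j"
proof -
  have "real (2 * i + 1) * real e < real (2 * j + 1) * real d"
    using assms(3) unfolding of_nat_mult[symmetric] of_nat_less_iff .
  then have "real (2 * i + 1) * pi / real (2 * d) < real (2 * j + 1) * pi / real (2 * e)"
    using assms(1,2) by (simp add: divide_less_eq less_divide_eq mult.commute mult.left_commute)
  then show ?thesis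
    unfolding critical_root_def using cot_strict_antimono angle_in_range assms by force
qed

text \<open>With \<open>\<phi>\<close> the angle in \<open>critical_root\<close>, the root \<open>z\<close> satisfies
  \<open>z + 1 = c cis \<phi>\<close> and \<open>z = c cis (- \<phi>)\<close> for \<open>c = - \<i> / (2 sin \<phi>)\<close>.\<close>

lemma poly_critical_root:
  assumes "j < d"
  shows "poly (power_sum_poly d) (Complex (- 1 / 2) (critical_root d j)) = 0"
proof -
  define \<phi> where "\<phi> = real (2 * j + 1) * pi / real (2 * d)"
  let ?z = "Complex (- 1 / 2) (critical_root d j)"
  let ?c = "Complex 0 (- 1 / (2 * sin \<phi>))"
  have s: "sin \<phi> > 0"
    unfolding \<phi>_def using angle_in_range[OF assms] by (rule sin_gt_zero)
  have z: "?z + 1 = ?c * cis \<phi>" "?z = ?c * cis (- \<phi>)"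
    unfolding critical_root_def \<phi>_def[symmetric] using s
    by (auto simp: complex_eq_iff cot_def)
  have "real d * \<phi> = real j * pi + pi / 2"
    using assms by (simp add: \<phi>_def field_simps)
  then have "cos (real d * \<phi>) = 0"
    by (simp add: cos_add)
  then have "cis (real d * \<phi>) + cis (- (real d * \<phi>)) = 0"
    by (simp add: complex_eq_iff)
  then have "cis \<phi> ^ d + cis (- \<phi>) ^ d = 0"
    unfolding Complex.DeMoivre mult_minus_right .
  then show ?thesis
    unfolding poly_power_sum_poly z(1) unfolding z(2)
    unfolding power_mult_distrib distrib_left[symmetric] by simp
qed

text \<open>The \<open>d\<close> listed zeros are distinct, and the degree is \<open>d\<close>, so
  they are all the zeros and each is simple.\<close>

lemma proots_power_sum_poly:
  "proots (power_sum_poly d) = mset (map (Complex (- 1 / 2)) (map (critical_root d) [0..<d]))"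
\<comment> \<open>For \<open>d = 0\<close> the polynomial is the constant 2; otherwise its positive
  degree shows that it is nonzero.\<close>
proof (cases "d = 0")
  case True
  then show ?thesis
    by (simp add: power_sum_poly_def)
next
  case False
  let ?xs = "map (Complex (- 1 / 2)) (map (critical_root d) [0..<d])"
  have nz: "power_sum_poly d \<noteq> 0"
    using False degree_power_sum_poly[of d] by auto
  have "inj_on (critical_root d) {0..<d}"
  proof (rule linorder_inj_onI)
    fix i j assume "i < j" "i \<in> {0..<d}" "j \<in> {0..<d}"
    then show "critical_root d i \<noteq> critical_root d j"
      using critical_root_less[of i d j d] by auto
  qed auto
  then have "distinct ?xs"
    by (auto simp: distinct_map inj_on_def)
  then have "mset ?xs = mset_set (set ?xs)"
    by (simp only: mset_set_set)
  also have "\<dots> \<subseteq># proots (power_sum_poly d)"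
    unfolding subseteq_mset_def
    using poly_critical_root nz by (auto simp: count_mset_set' Suc_le_eq order_gt_0_iff)
  finally have "mset ?xs \<subseteq># proots (power_sum_poly d)" .
  moreover have "size (proots (power_sum_poly d)) = d"
    by (simp add: size_proots_complex degree_power_sum_poly)
  ultimately show ?thesis
    by (metis mset_subset_size size_mset length_map length_upt minus_nat.diff_0 nless_le subset_mset.le_less)
qed

theorem theorem2:
  shows "(\<forall>d\<ge>1. CL_polytope d (dual_polytope d (C_polytope d))) \<and>
    critical_line_interlacing (\<lambda>d. ehrhart_poly d (dual_polytope d (C_polytope d)))"
proof (intro conjI allI impI)
  fix d :: nat assume "1 \<le> d"
  then have d: "d > 0"
    by simp
  have "Re z = - 1 / 2" if "poly (power_sum_poly d) z = 0" for z
  proof -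
    have "power_sum_poly d \<noteq> 0"
      using d degree_power_sum_poly[of d] by auto
    then have "z \<in># proots (power_sum_poly d)"
      using that by simp
    then show ?thesis
      unfolding proots_power_sum_poly by auto
  qed
  then show "CL_polytope d (dual_polytope d (C_polytope d))"
    unfolding CL_polytope_def ehrhart_poly_dual_C_polytope[OF d]
    using reflexive_dual_C_polytope[OF d] by blast
next
  have sorted: "sorted (map (critical_root d) [0..<d])" for d
    by (auto simp: sorted_iff_nth_mono_less intro!: less_imp_le critical_root_less)
  show "critical_line_interlacing (\<lambda>d. ehrhart_poly d (dual_polytope d (C_polytope d)))"
    unfolding critical_line_interlacing_def
  proof (intro allI impI)
    fix d :: nat assume "1 \<le> d"
    then have d: "d > 0" "d + 1 > 0"
      by simp_all
    \<comment> \<open>After clearing denominators these are (2i+1) d < (2i+1) (d+1) and (2i+1) (d+1)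
      < (2i+3) d; the latter amounts to 2i+1 < 2d.\<close>
    have "critical_root (d + 1) i \<le> critical_root d i"
      "critical_root d i \<le> critical_root (d + 1) (i + 1)" if "i < d" for i
      using that by (auto intro!: less_imp_le critical_root_less simp: algebra_simps)
    then show "\<exists>ts ss :: real list.
        length ts = d + 1 \<and> sorted ts \<and>
        proots (ehrhart_poly (d + 1) (dual_polytope (d + 1) (C_polytope (d + 1)))) =
          mset (map (\<lambda>t. Complex (- 1 / 2) t) ts) \<and>
        length ss = d \<and> sorted ss \<and>
        proots (ehrhart_poly d (dual_polytope d (C_polytope d))) =
          mset (map (\<lambda>s. Complex (- 1 / 2) s) ss) \<and>
        (\<forall>i<d. ts ! i \<le> ss ! i \<and> ss ! i \<le> ts ! (i + 1))"
      unfolding ehrhart_poly_dual_C_polytope[OF d(1)] ehrhart_poly_dual_C_polytope[OF d(2)]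
      by (intro exI[of _ "map (critical_root (d + 1)) [0..<d + 1]"]
          exI[of _ "map (critical_root d) [0..<d]"] conjI sorted proots_power_sum_poly)
        (simp_all add: nth_append del: upt_Suc)
  qed
qed

end
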